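(* Let $G$ be a $2$-connected nontrivial uniquely $C_9$-saturated graph, let $C$ be a longest even cycle among the even cycles of $G$ of length at most $12$, and suppose that $C$ has length $12$. Let $R=V(G)\setminus V(C)$. Then $R$ is an independent set of $G$.
   Context: All graphs are finite and simple. A graph $G$ is uniquely $C_9$-saturated if it contains no cycle of length $9$ and, for every edge $e$ of the complement $\overline{G}$, $G+e$ contains exactly one cycle of length $9$; it is nontrivial if $|V(G)|\ge 9$. *)

theory Defs
  imports "Graph_Theory.Graph_Theory"
begin

text \<open>
  A finite simple graph is a \<^locale>\<open>pair_graph\<close>: the edge \<open>uv\<close> is represented by the two arcs
  \<open>(u, v)\<close> and \<open>(v, u)\<close>.
\<close>

text \<open>
  Cycles are subgraphs, so that counting them does not distinguish starting points or
  directions of traversal. The library's \<^const>\<open>pre_digraph.cycle\<close> is a list of arcs, and it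
  admits the closed walk \<open>u, v, u\<close> of length 2; hence the bound \<open>3 \<le> length p\<close>.
\<close>

definition cycle_subgraph :: "'a pair_pre_digraph \<Rightarrow> 'a pair_pre_digraph \<Rightarrow> bool" where
  "cycle_subgraph G C \<longleftrightarrow>
     (\<exists>p. pre_digraph.cycle (with_proj G) p \<and> 3 \<le> length p \<and>
          C = \<lparr> pverts = fst ` set p, parcs = set p \<union> (set p)\<inverse> \<rparr>)"

definition cycle_length :: "'a pair_pre_digraph \<Rightarrow> nat" where
  "cycle_length C = card (pverts C)"

definition add_edge :: "'a pair_pre_digraph \<Rightarrow> 'a \<Rightarrow> 'a \<Rightarrow> 'a pair_pre_digraph" where
  "add_edge G u v = \<lparr> pverts = pverts G, parcs = parcs G \<union> {(u, v), (v, u)} \<rparr>"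

definition graph_complement :: "'a pair_pre_digraph \<Rightarrow> 'a pair_pre_digraph" where
  "graph_complement G =
     \<lparr> pverts = pverts G,
       parcs = {(u, v). u \<in> pverts G \<and> v \<in> pverts G \<and> u \<noteq> v \<and> (u, v) \<notin> parcs G} \<rparr>"

definition uniquely_cycle_saturated :: "nat \<Rightarrow> 'a pair_pre_digraph \<Rightarrow> bool" where
  "uniquely_cycle_saturated k G \<longleftrightarrow>
     (\<nexists>C. cycle_subgraph G C \<and> cycle_length C = k) \<and>
     (\<forall>(u, v) \<in> parcs (graph_complement G).
        \<exists>!C. cycle_subgraph (add_edge G u v) C \<and> cycle_length C = k)"

definition vertex_connected :: "nat \<Rightarrow> 'a pair_pre_digraph \<Rightarrow> bool" where
  "vertex_connected k G \<longleftrightarrow>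
     k < card (pverts G) \<and>
     (\<forall>X \<subseteq> pverts G. card X < k \<longrightarrow> connected (with_proj G \<restriction> (pverts G - X)))"

definition longest_even_cycle_upto ::
    "nat \<Rightarrow> 'a pair_pre_digraph \<Rightarrow> 'a pair_pre_digraph \<Rightarrow> bool" where
  "longest_even_cycle_upto m G C \<longleftrightarrow>
     is_arg_max cycle_length
       (\<lambda>D. cycle_subgraph G D \<and> even (cycle_length D) \<and> cycle_length D \<le> m) C"

definition independent_set :: "'a pair_pre_digraph \<Rightarrow> 'a set \<Rightarrow> bool" where
  "independent_set G S \<longleftrightarrow> S \<subseteq> pverts G \<and> (\<forall>u \<in> S. \<forall>v \<in> S. (u, v) \<notin> parcs G)"

end

theory Submission
  imports Defs
begin

text \<open>
  Suppose that \<open>R\<close> contains an edge. As \<open>G\<close> is connected, some edge \<open>xy\<close> inside \<open>R\<close> has its end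
  \<open>x\<close> adjacent to the 12-cycle; label that cycle \<open>v\<^sub>0, \<dots>, v\<^sub>1\<^sub>1\<close> with \<open>v\<^sub>0\<close> adjacent to \<open>x\<close>. The vertex
  \<open>v\<^sub>6\<close> is antipodal to \<open>v\<^sub>0\<close>, so there are two paths of length 8 from \<open>y\<close> to \<open>v\<^sub>6\<close>: both start
  with \<open>y, x, v\<^sub>0\<close>, and they go round the cycle in opposite directions.

  If \<open>y\<close> and \<open>v\<^sub>6\<close> were not adjacent, adding the edge \<open>yv\<^sub>6\<close> would close both paths to different
  9-cycles, against uniqueness (\<open>adjacent_if_two_closing_paths\<close>). So they are adjacent, and
  \<open>y, x, v\<^sub>0, \<dots>, v\<^sub>6\<close> is already a 9-cycle of \<open>G\<close>, which is impossible.
\<close>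

text \<open>
  Pairing a list with its own rotation gives each vertex its cyclic successor, the last one being
  followed by the first. In this form a cycle is visibly unaffected by rotating the list, so its
  labelling can start at any chosen vertex.
\<close>

abbreviation cyclic_arcs :: "'a list \<Rightarrow> ('a \<times> 'a) set" where
  "cyclic_arcs vs \<equiv> set (zip vs (rotate1 vs))"

abbreviation list_cycle :: "'a list \<Rightarrow> 'a pair_pre_digraph" where
  "list_cycle vs \<equiv> \<lparr> pverts = set vs, parcs = cyclic_arcs vs \<union> (cyclic_arcs vs)\<inverse> \<rparr>"

lemma pcas_zip: "pcas u (zip (u # vs) (vs @ [w])) w"
  by (induction vs arbitrary: u) auto

lemma pcas_map_snd: "pcas u p w \<Longrightarrow> p \<noteq> [] \<Longrightarrow> map snd p = tl (map fst p) @ [w]"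
proof (induction p arbitrary: u)
  case (Cons e p)
  then show ?case by (cases p) auto
qed simp

lemma pcas_pawalk_verts: "pcas u p w \<Longrightarrow> pawalk_verts u p = map fst p @ [w]"
  by (induction p arbitrary: u) auto

lemma cycle_subgraph_list_cycle:
  assumes "3 \<le> length vs" "distinct vs" "hd vs \<in> pverts H" "cyclic_arcs vs \<subseteq> parcs H"
  shows "cycle_subgraph H (list_cycle vs)"
proof -
  define p where "p = zip vs (rotate1 vs)"
  from assms(1) obtain u us where vs: "vs = u # us"
    by (cases vs) auto
  have fst: "map fst p = vs"
    by (simp add: p_def)
  have cas: "pcas u p u"
    unfolding p_def vs using pcas_zip[of u us u] by simp
  have "tl (pawalk_verts u p) = rotate1 vs"
    using pcas_pawalk_verts[OF cas] fst vs by simp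
  then have "pre_digraph.cycle (with_proj H) p"
    using assms cas unfolding pre_digraph.cycle_def pre_digraph.awalk_def
    by (intro exI[of _ u]) (auto simp: p_def vs cas_with_proj_eq awalk_verts_with_proj_eq)
  moreover have "fst ` set p = set vs"
    using fst by (metis list.set_map)
  ultimately show ?thesis
    using assms(1) unfolding cycle_subgraph_def by (intro exI[of _ p]) (simp add: p_def)
qed

lemma cycle_subgraphE:
  assumes "cycle_subgraph H D"
  obtains vs where "distinct vs" "cyclic_arcs vs \<subseteq> parcs H" "D = list_cycle vs"
proof -
  from assms obtain p u where cas: "pcas u p u" and ne: "p \<noteq> []"
    and dist: "distinct (tl (pawalk_verts u p))" and sub: "set p \<subseteq> parcs H"
    and D: "D = \<lparr> pverts = fst ` set p, parcs = set p \<union> (set p)\<inverse> \<rparr>"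
    unfolding cycle_subgraph_def pre_digraph.cycle_def pre_digraph.awalk_def
    by (auto simp: cas_with_proj_eq awalk_verts_with_proj_eq)
  define vs where "vs = map fst p"
  have u: "u = hd vs"
    using cas ne by (cases p) (auto simp: vs_def)
  have rot: "rotate1 vs = tl vs @ [u]"
    using ne u by (cases p) (auto simp: vs_def)
  have "map snd p = rotate1 vs"
    using pcas_map_snd[OF cas ne] rot by (simp add: vs_def)
  then have p: "zip vs (rotate1 vs) = p"
    by (metis vs_def zip_map_fst_snd)
  have "tl (pawalk_verts u p) = rotate1 vs"
    using pcas_pawalk_verts[OF cas] rot ne by (simp add: vs_def)
  with dist have "distinct vs" by simp
  moreover have "D = list_cycle vs"
    using D p by (simp add: vs_def)
  ultimately show thesis
    using that sub p by metis
qed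

lemma zip_rotate1: "length xs = length ys \<Longrightarrow> zip (rotate1 xs) (rotate1 ys) = rotate1 (zip xs ys)"
  by (cases xs; cases ys) auto

lemma cyclic_arcs_rotate: "cyclic_arcs (rotate k vs) = cyclic_arcs vs"
  by (induction k) (simp_all add: zip_rotate1)

text \<open>
  The lists \<open>ps\<close> and \<open>qs\<close> stand for two paths of \<open>G\<close> from \<open>u\<close> to \<open>v\<close>: the only cyclic arc of such
  a list that can be missing from \<open>G\<close> is the one closing the path, from \<open>v\<close> back to \<open>u\<close>. Adding the
  edge \<open>uv\<close> to \<open>G\<close> would turn each path into a cycle of length \<open>k\<close>, and cycles with different
  vertex sets are different.
\<close>

lemma adjacent_if_two_closing_paths:
  assumes sat: "uniquely_cycle_saturated k G" and k: "3 \<le> k"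
    and ends: "u \<in> pverts G" "v \<in> pverts G" "u \<noteq> v"
    and ps: "distinct ps" "length ps = k" "hd ps = u" "cyclic_arcs ps \<subseteq> insert (v, u) (parcs G)"
    and qs: "distinct qs" "length qs = k" "hd qs = u" "cyclic_arcs qs \<subseteq> insert (v, u) (parcs G)"
    and different: "set ps \<noteq> set qs"
  shows "(u, v) \<in> parcs G"
proof (rule ccontr)
  assume "(u, v) \<notin> parcs G"
  with ends have "(u, v) \<in> parcs (graph_complement G)"
    by (simp add: graph_complement_def)
  with sat have unique: "\<exists>!D. cycle_subgraph (add_edge G u v) D \<and> cycle_length D = k"
    unfolding uniquely_cycle_saturated_def by blast
  have closed: "cycle_subgraph (add_edge G u v) (list_cycle rs) \<and> cycle_length (list_cycle rs) = k"
    if "distinct rs" "length rs = k" "hd rs = u" "cyclic_arcs rs \<subseteq> insert (v, u) (parcs G)" for rs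
    using that k ends
    by (auto intro!: cycle_subgraph_list_cycle simp: add_edge_def cycle_length_def distinct_card)
  have "list_cycle ps = list_cycle qs"
    using unique closed[OF ps] closed[OF qs] by blast
  with different show False
    by simp
qed

lemma no_cyclic_sequence:
  assumes "uniquely_cycle_saturated k G" "3 \<le> k"
    and "distinct vs" "length vs = k" "hd vs \<in> pverts G" "cyclic_arcs vs \<subseteq> parcs G"
  shows False
  using assms cycle_subgraph_list_cycle[of vs G]
  by (auto simp: uniquely_cycle_saturated_def cycle_length_def distinct_card)

lemma connected_closed_set_eq_verts:
  assumes "pair_graph G" "connected (with_proj G)"
    and "S \<subseteq> pverts G" "S \<noteq> {}"
    and closed: "\<And>s t. s \<in> S \<Longrightarrow> (s, t) \<in> parcs G \<Longrightarrow> t \<in> S"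
  shows "S = pverts G"
proof -
  interpret pair_graph G by fact
  have closed': "t \<in> S" if "s \<in> S" "(s, t) \<in> (parcs G)\<^sup>s" for s t
    using that closed arcs_symmetric by (auto simp: symcl_def)
  obtain s where s: "s \<in> S" using assms(4) by auto
  have "t \<in> S" if "t \<in> pverts G" for t
  proof -
    have "(s, t) \<in> rtrancl_on (pverts G) ((parcs G)\<^sup>s)"
      using assms(2,3) s that by (auto simp: connected_conv)
    then show ?thesis
      using s by induction (auto intro: closed')
  qed
  with assms(3) show ?thesis by auto
qed

lemma connected_if_vertex_connected:
  assumes "pair_graph G" "vertex_connected k G" "0 < k"
  shows "connected (with_proj G)"
proof -
  interpret pair_graph G by fact
  have "with_proj G \<restriction> pverts G = with_proj G"
    by (auto simp: induce_subgraph_def with_proj_def dest: in_arcsD1 in_arcsD2)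
  moreover have "connected (with_proj G \<restriction> (pverts G - {}))"
    using assms(2,3) unfolding vertex_connected_def by (metis card.empty empty_subsetI)
  ultimately show ?thesis by simp
qed

text \<open>
  The vertices outside \<open>S\<close> that have a neighbour outside \<open>S\<close> would otherwise form a set closed
  under adjacency, hence be all of \<open>G\<close>.
\<close>

lemma obtain_outer_edge_adjacent_to_set:
  assumes "pair_graph G" "connected (with_proj G)" "S \<subseteq> pverts G" "S \<noteq> {}"
    and "a \<notin> S" "b \<notin> S" "(a, b) \<in> parcs G"
  obtains x y v where "x \<notin> S" "y \<notin> S" "(x, y) \<in> parcs G" "v \<in> S" "(x, v) \<in> parcs G"
proof (rule ccontr)
  assume no: "\<not> thesis"
  interpret pair_graph G by fact
  define T where "T = {x \<in> pverts G - S. \<exists>y. y \<notin> S \<and> (x, y) \<in> parcs G}"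
  have "T = pverts G"
  proof (rule connected_closed_set_eq_verts[OF assms(1,2)])
    show "T \<noteq> {}"
      using assms by (auto simp: T_def dest: in_arcsD1)
    fix s t assume "s \<in> T" "(s, t) \<in> parcs G"
    then show "t \<in> T"
      using that no arcs_symmetric by (auto simp: T_def dest: in_arcsD2)
  qed (auto simp: T_def)
  with assms(3,4) show False
    by (auto simp: T_def)
qed

theorem lemma3p1:
  fixes G C :: "'a pair_pre_digraph" and R :: "'a set"
  assumes "pair_graph G"
    and "vertex_connected 2 G"
    and "uniquely_cycle_saturated 9 G"
    and "card (pverts G) \<ge> 9"
    and "longest_even_cycle_upto 12 G C"
    and "cycle_length C = 12"
    and "R = pverts G - pverts C"
  shows "independent_set G R"
proof (rule ccontr)
  assume "\<not> independent_set G R"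
  interpret pair_graph G by fact
  have sym: "(v, u) \<in> parcs G" if "(u, v) \<in> parcs G" for u v
    using that arcs_symmetric by blast
  from \<open>\<not> independent_set G R\<close> obtain a b where ab: "a \<in> R" "b \<in> R" "(a, b) \<in> parcs G"
    using assms(7) by (auto simp: independent_set_def)
  have "cycle_subgraph G C"
    using assms(5) by (simp add: longest_even_cycle_upto_def is_arg_max_def)
  then obtain vs where vs: "distinct vs" "cyclic_arcs vs \<subseteq> parcs G" "C = list_cycle vs"
    by (rule cycle_subgraphE)
  have len: "length vs = 12"
    using vs assms(6) by (simp add: cycle_length_def distinct_card)
  have "set vs \<subseteq> pverts G"
  proof
    fix w assume "w \<in> set vs"
    then have "w \<in> fst ` cyclic_arcs vs"
      by (metis length_rotate1 list.set_map map_fst_zip)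
    then show "w \<in> pverts G"
      using vs(2) by (auto dest: in_arcsD1)
  qed
  moreover have "set vs \<noteq> {}"
    using len by auto
  moreover have "a \<notin> set vs" "b \<notin> set vs"
    using ab assms(7) vs(3) by simp_all
  moreover have "connected (with_proj G)"
    using assms(1,2) by (rule connected_if_vertex_connected) simp
  ultimately obtain x y v where xy: "x \<notin> set vs" "y \<notin> set vs" "(x, y) \<in> parcs G"
    and v: "v \<in> set vs" "(x, v) \<in> parcs G"
    using obtain_outer_edge_adjacent_to_set[OF assms(1)] ab(3) by metis
  \<comment> \<open>Rotate the cycle so that it starts at the neighbour \<open>v\<close> of \<open>x\<close>.\<close>
  obtain k where k: "k < length vs" "v = vs ! k"
    using v(1) by (metis in_set_conv_nth)
  define ws where "ws = rotate k vs"
  have "vs \<noteq> []"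
    using len by auto
  then have ws: "distinct ws" "length ws = 12" "cyclic_arcs ws \<subseteq> parcs G" "hd ws = v"
      "set ws = set vs"
    using vs len k by (auto simp: ws_def cyclic_arcs_rotate hd_rotate_conv_nth)
  from ws(2) obtain v0 v1 v2 v3 v4 v5 v6 v7 v8 v9 v10 v11
    where ws_eq: "ws = [v0, v1, v2, v3, v4, v5, v6, v7, v8, v9, v10, v11]"
    by (auto simp: numeral_eq_Suc length_Suc_conv)
  have arcs: "(v0, v1) \<in> parcs G" "(v1, v2) \<in> parcs G" "(v2, v3) \<in> parcs G" "(v3, v4) \<in> parcs G"
      "(v4, v5) \<in> parcs G" "(v5, v6) \<in> parcs G" "(v6, v7) \<in> parcs G" "(v7, v8) \<in> parcs G"
      "(v8, v9) \<in> parcs G" "(v9, v10) \<in> parcs G" "(v10, v11) \<in> parcs G" "(v11, v0) \<in> parcs G"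
    using ws(3) by (simp_all add: ws_eq)
  have v0: "(x, v0) \<in> parcs G"
    using v(2) ws(4) ws_eq by simp
  have xy': "x \<notin> set ws" "y \<notin> set ws" "x \<noteq> y"
    using xy ws(5) no_loops[of "(x, y)"] by auto
  \<comment> \<open>From \<open>v0\<close>, the first path goes forwards round the cycle to \<open>v6\<close>, the second backwards.\<close>
  let ?ps = "[y, x, v0, v1, v2, v3, v4, v5, v6]"
  let ?qs = "[y, x, v0, v11, v10, v9, v8, v7, v6]"
  have "y \<in> pverts G" "v6 \<in> pverts G"
    using xy(3) arcs by (auto dest: in_arcsD1 in_arcsD2)
  \<comment> \<open>The vertex \<open>v1\<close> lies on the first path only. The reversed list gives the inequations
    between the vertices of the second path in the order in which it visits them.\<close>
  have "v1 \<in> set ws"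
    by (simp add: ws_eq)
  then have "distinct (rev ws)" "v1 \<noteq> x" "v1 \<noteq> y"
    using ws(1) xy' by auto
  then have dist: "distinct ?ps" "distinct ?qs" and "y \<noteq> v6" and v1: "v1 \<notin> set ?qs"
    using ws(1) xy' by (simp_all add: ws_eq)
  have "v1 \<in> set ?ps"
    by simp
  then have different: "set ?ps \<noteq> set ?qs"
    using v1 by blast
  have "(y, v6) \<in> parcs G"
  proof (rule adjacent_if_two_closing_paths)
    show "cyclic_arcs ?ps \<subseteq> insert (v6, y) (parcs G)" "cyclic_arcs ?qs \<subseteq> insert (v6, y) (parcs G)"
      using arcs v0 xy(3) by (simp_all add: sym)
  qed (use assms(3) dist different \<open>y \<in> pverts G\<close> \<open>v6 \<in> pverts G\<close> \<open>y \<noteq> v6\<close> in \<open>fact | simp\<close>)+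
  then have "cyclic_arcs ?ps \<subseteq> parcs G"
    using arcs v0 xy(3) by (simp add: sym)
  then show False
    using no_cyclic_sequence[OF assms(3) _ dist(1)] \<open>y \<in> pverts G\<close> by simp
qed

end
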